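(* Let $r_i,a_i,b_i,c_i$ ($i=1,2,3$) and $a_{ij},b_{ij},c_{ij}$ ($1\le i\le j\le 3$) be real parameters, and consider the cubic Kolmogorov system in $\mathbb{R}^3$ $$\begin{cases} \frac{dx_1}{dt}=x_1\big(r_1+\sum_{i=1}^3a_ix_i+\sum_{1\le i\le j\le 3}a_{ij}x_ix_j\big),\\ \frac{dx_2}{dt}=x_2\big(r_2+\sum_{i=1}^3b_ix_i+\sum_{1\le i\le j\le 3}b_{ij}x_ix_j\big),\\ \frac{dx_3}{dt}=x_3\big(r_3+\sum_{i=1}^3c_ix_i+\sum_{1\le i\le j\le 3}c_{ij}x_ix_j\big). \end{cases}$$ The system has $\mathbb{S}^2$ as an invariant sphere in $\mathbb{R}^3$ if and only if $$\begin{cases} a_i=b_i=c_i=0,\quad i=1,2,3,\\ a_{ij}=b_{ij}=c_{ij}=0,\quad i\neq j,\\ a_{11}=-r_1,\quad a_{22}=-(r_1+r_2+b_{11}),\\ b_{22}=-r_2,\quad b_{33}=-(r_2+r_3+c_{22}),\\ c_{11}=-(r_1+r_3+a_{33}),\quad c_{33}=-r_3. \end{cases}$$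
   Context: $\mathbb{S}^2=\{(x_1,x_2,x_3)\in\mathbb{R}^3: x_1^2+x_2^2+x_3^2=1\}$ is the Euclidean unit sphere. It is an invariant sphere of the system if it is invariant under the flow of the system. *)

theory Defs
  imports "HOL-Analysis.Analysis"
begin

text \<open>
  Coefficients are indexed by \<^typ>\<open>nat\<close>, because in the order on the index type
  \<^typ>\<open>3\<close> the element \<^term>\<open>3 :: 3\<close> is \<^term>\<open>0 :: 3\<close>, so \<open>i \<le> j\<close> would not mean what it should there.
  Only the values at \<open>1 \<le> i \<le> j \<le> 3\<close> matter.
\<close>

definition quadratic_factor ::
  "real \<Rightarrow> (nat \<Rightarrow> real) \<Rightarrow> (nat \<Rightarrow> nat \<Rightarrow> real) \<Rightarrow> real ^ 3 \<Rightarrow> real" where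
  "quadratic_factor \<rho> l q x =
     \<rho> + (\<Sum>i=1..3. l i * x $ of_nat i)
       + (\<Sum>i=1..3. \<Sum>j=i..3. q i j * x $ of_nat i * x $ of_nat j)"

definition kolmogorov_field ::
  "(nat \<Rightarrow> real) \<Rightarrow> (nat \<Rightarrow> real) \<Rightarrow> (nat \<Rightarrow> real) \<Rightarrow> (nat \<Rightarrow> real) \<Rightarrow>
   (nat \<Rightarrow> nat \<Rightarrow> real) \<Rightarrow> (nat \<Rightarrow> nat \<Rightarrow> real) \<Rightarrow> (nat \<Rightarrow> nat \<Rightarrow> real) \<Rightarrow>
   real ^ 3 \<Rightarrow> real ^ 3" where
  "kolmogorov_field r a b c a2 b2 c2 x =
     vector [x $ 1 * quadratic_factor (r 1) a a2 x,
             x $ 2 * quadratic_factor (r 2) b b2 x,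
             x $ 3 * quadratic_factor (r 3) c c2 x]"

definition is_solution ::
  "('a::real_normed_vector \<Rightarrow> 'a) \<Rightarrow> real set \<Rightarrow> (real \<Rightarrow> 'a) \<Rightarrow> bool" where
  "is_solution F I x \<longleftrightarrow> open I \<and> is_interval I \<and>
     (\<forall>t\<in>I. (x has_vector_derivative F (x t)) (at t))"

text \<open>
  The flow of a polynomial field is in general only local (solutions may blow up in finite time),
  so invariance is expressed through all solutions on open, possibly bounded, time intervals;
  both forward and backward times are included.
\<close>

definition flow_invariant ::
  "('a::real_normed_vector \<Rightarrow> 'a) \<Rightarrow> 'a set \<Rightarrow> bool" where
  "flow_invariant F S \<longleftrightarrow>
     (\<forall>I x. is_solution F I x \<longrightarrow>
        (\<forall>t0\<in>I. x t0 \<in> S \<longrightarrow> (\<forall>t\<in>I. x t \<in> S)))"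

end

theory Submission imports Defs begin

text \<open>
  Invariance of the unit sphere is equivalent to tangency of the field \<open>F\<close> along it. Invariance gives
  \<open>y \<bullet> F y = 0\<close> on the sphere by differentiating \<open>x \<bullet> x\<close> along a solution through \<open>y\<close>, which exists by
  Picard iteration; this is needed because invariance would hold vacuously at points with no solution.
  Restricting the quartic \<open>y \<bullet> F y\<close> to the three coordinate great circles then gives all relations
  except \<open>a\<^sub>2\<^sub>3 = b\<^sub>1\<^sub>3 = c\<^sub>1\<^sub>2 = 0\<close>, and what is left of it is \<open>uvw (a\<^sub>2\<^sub>3 u + b\<^sub>1\<^sub>3 v + c\<^sub>1\<^sub>2 w)\<close>.
  Conversely, the relations make \<open>y \<bullet> F y\<close> a multiple of \<open>y \<bullet> y - 1\<close>, so along a solution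
  \<open>x \<bullet> x - 1\<close> satisfies a homogeneous linear equation and vanishes identically once it vanishes.
\<close>

section \<open>Local existence of solutions by Picard iteration\<close>

lemma lipschitz_ode_local_solution:
  fixes G :: "'a::banach \<Rightarrow> 'a"
  assumes lip: "L-lipschitz_on UNIV G"
  obtains d x where "d > 0" "x 0 = x0" "is_solution G {-d<..<d} x"
proof -
  \<comment> \<open>The two integrals in \<open>\<Phi>\<close> run over length at most
    \<open>2 * d\<close> each, so its Lipschitz constant is at most \<open>4 * d * L\<close>; this
    \<open>d\<close> makes that at most 2/3. Using \<open>L + 1\<close> keeps the quotient
    meaningful when \<open>L = 0\<close>.\<close>
  define d where "d = 1 / (6 * (L + 1))"
  have L: "L \<ge> 0" using lip by (rule lipschitz_on_nonneg)
  hence d: "d > 0" "3 * d * L \<le> 1/2" by (auto simp: d_def field_simps)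
  \<comment> \<open>Integrating from \<open>-d\<close> instead of 0 gives one antiderivative on all
    of \<open>[-d, d]\<close>, valid for negative times too; subtracting \<open>J f 0\<close> in
    \<open>\<Phi>\<close> restores the initial value \<open>x0\<close>.\<close>
  define J where "J f s = integral {-d..s} (G \<circ> f)" for f s
  \<comment> \<open>Clipping time to \<open>[-d, d]\<close> turns the Picard operator into a self-map of the
    bounded continuous functions on the whole line.\<close>
  define clip where "clip t = max (-d) (min d t)" for t :: real
  define \<Phi> where "\<Phi> f t = x0 + J f (clip t) - J f 0" for f t
  have clip: "clip t \<in> {-d..d}" for t
    using d by (auto simp: clip_def)
  have contG: "continuous_on A (G \<circ> apply_bcontfun f)" for A and f :: "real \<Rightarrow>\<^sub>C 'a"
    by (intro continuous_on_compose continuous_on_subset[OF lipschitz_on_continuous_on[OF lip]]) auto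
  have J: "(J (apply_bcontfun f) has_vector_derivative G (f s)) (at s within {-d..d})"
    if "s \<in> {-d..d}" for f s
    using integral_has_vector_derivative[OF contG that, of f] unfolding J_def by simp
  have contJ: "continuous_on {-d..d} (J (apply_bcontfun f))" for f
    using J has_vector_derivative_continuous continuous_on_eq_continuous_within by blast
  have bcont: "\<Phi> (apply_bcontfun f) \<in> bcontfun" for f
  proof -
    have "bounded (J (apply_bcontfun f) ` {-d..d})"
      using contJ compact_imp_bounded compact_continuous_image by blast
    then obtain B where B: "\<And>s. s \<in> {-d..d} \<Longrightarrow> norm (J (apply_bcontfun f) s) \<le> B"
      unfolding bounded_iff by blast
    show ?thesis
    proof (rule bcontfun_normI)
      show "continuous_on UNIV (\<Phi> (apply_bcontfun f))"
        unfolding \<Phi>_def clip_def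
        by (intro continuous_intros continuous_on_compose2[OF contJ]) (use d in auto)
      show "norm (\<Phi> (apply_bcontfun f) t) \<le> norm x0 + B + B" for t
        unfolding \<Phi>_def using B[OF clip, of t] B[of 0] d
        by (intro norm_triangle_le_diff norm_triangle_le add_mono) auto
    qed
  qed
  define \<Psi> where "\<Psi> f = Bcontfun (\<Phi> (apply_bcontfun f))" for f
  have \<Psi>: "apply_bcontfun (\<Psi> f) = \<Phi> (apply_bcontfun f)" for f
    unfolding \<Psi>_def by (rule Bcontfun_inverse[OF bcont])
  have diffJ: "norm (J (apply_bcontfun f) s - J (apply_bcontfun g) s) \<le> 2 * d * L * dist f g"
    if s: "s \<in> {-d..d}" for f g s
  proof -
    have int: "G \<circ> apply_bcontfun h integrable_on {-d..s}" for h
      by (rule integrable_continuous_real[OF contG])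
    have "J (apply_bcontfun f) s - J (apply_bcontfun g) s =
        integral {-d..s} (\<lambda>t. G (f t) - G (g t))"
      unfolding J_def using integral_diff[OF int int, of f g] by (simp add: o_def)
    also have "norm \<dots> \<le> (L * dist f g) * (s - (-d))"
    proof (rule integral_bound)
      show "continuous_on {-d..s} (\<lambda>t. G (f t) - G (g t))"
        using contG[of "{-d..s}"] by (intro continuous_on_diff) (auto simp: o_def)
      show "norm (G (f t) - G (g t)) \<le> L * dist f g" for t
        using lipschitz_onD[OF lip, of "f t" "g t"] dist_bounded[of f t g] L
        by (smt (verit) UNIV_I dist_norm mult_left_mono)
    qed (use s in auto)
    also have "\<dots> \<le> (L * dist f g) * (2 * d)"
      using s L by (intro mult_left_mono) auto
    finally show ?thesis by (simp add: algebra_simps)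
  qed
  have "dist (\<Psi> f) (\<Psi> g) \<le> 2/3 * dist f g" for f g
  proof (rule dist_bound)
    fix t
    have "dist (\<Psi> f t) (\<Psi> g t) =
        norm ((J (apply_bcontfun f) (clip t) - J (apply_bcontfun g) (clip t))
          - (J (apply_bcontfun f) 0 - J (apply_bcontfun g) 0))"
      unfolding \<Psi> \<Phi>_def dist_norm by (simp add: algebra_simps)
    also have "\<dots> \<le> 2 * d * L * dist f g + 2 * d * L * dist f g"
      using d(1) by (intro order_trans[OF norm_triangle_ineq4 add_mono] diffJ clip) auto
    also have "\<dots> = (4 / 3) * (3 * d * L) * dist f g" by simp
    also have "\<dots> \<le> (4 / 3) * (1 / 2) * dist f g"
      using d by (intro mult_right_mono mult_left_mono) auto
    finally show "dist (\<Psi> f t) (\<Psi> g t) \<le> 2/3 * dist f g" by simp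
  qed
  then obtain x where x: "\<Psi> x = x"
    using banach_fix_type[of "2/3" \<Psi>] by auto
  have xt: "x t = x0 + J (apply_bcontfun x) (clip t) - J (apply_bcontfun x) 0" for t
    using \<Psi>[of x] unfolding x \<Phi>_def by metis
  \<comment> \<open>Inside the open interval \<open>clip\<close> is the identity, so the fixed-point
    equation is the integral equation of the ODE.\<close>
  have "(apply_bcontfun x has_vector_derivative G (x t)) (at t)" if t: "t \<in> {-d<..<d}" for t
  proof -
    have "(J (apply_bcontfun x) has_vector_derivative G (x t)) (at t)"
      using J[of t x] t by (simp add: at_within_Icc_at)
    hence "((\<lambda>s. x0 + J (apply_bcontfun x) s - J (apply_bcontfun x) 0)
        has_vector_derivative G (x t)) (at t)"
      by (auto intro!: derivative_eq_intros)
    thus ?thesis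
      by (rule has_vector_derivative_transform_within_open[OF _ open_greaterThanLessThan t])
         (use xt in \<open>auto simp: clip_def\<close>)
  qed
  moreover have "x 0 = x0" using xt[of 0] d by (simp add: clip_def)
  ultimately show ?thesis
    using d by (intro that[of d "apply_bcontfun x"])
      (auto simp: is_solution_def is_interval_oo)
qed

lemma locally_lipschitz_ode_local_solution:
  fixes F :: "'a::euclidean_space \<Rightarrow> 'a"
  assumes u: "u > 0" and lip: "L-lipschitz_on (cball x0 u) F"
  obtains d x where "d > 0" "x 0 = x0" "is_solution F {-d<..<d} x"
proof -
  \<comment> \<open>Composing with the nearest-point map onto the ball makes the field globally Lipschitz.\<close>
  define P where "P = closest_point (cball x0 u)"
  have P: "P y \<in> cball x0 u" for y
    unfolding P_def using u by (intro closest_point_in_set) auto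
  have "L-lipschitz_on UNIV (F \<circ> P)"
  proof (rule lipschitz_onI)
    show L: "L \<ge> 0" using lip by (rule lipschitz_on_nonneg)
    fix y z
    have "dist (F (P y)) (F (P z)) \<le> L * dist (P y) (P z)"
      using lip P by (intro lipschitz_onD)
    also have "\<dots> \<le> L * dist y z"
      unfolding P_def using u L by (intro mult_left_mono closest_point_lipschitz) auto
    finally show "dist ((F \<circ> P) y) ((F \<circ> P) z) \<le> L * dist y z" by simp
  qed
  then obtain d x where d: "d > 0" and x0: "x 0 = x0" and sol: "is_solution (F \<circ> P) {-d<..<d} x"
    by (rule lipschitz_ode_local_solution)
  have deriv: "(x has_vector_derivative F (P (x t))) (at t)" if "t \<in> {-d<..<d}" for t
    using sol that by (auto simp: is_solution_def)
  have "isCont x 0"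
    using deriv[of 0] d has_vector_derivative_continuous by auto
  then obtain e where e: "e > 0" "\<And>t. dist t 0 < e \<Longrightarrow> dist (x t) (x 0) < u"
    using u unfolding continuous_at_eps_delta dist_norm by blast
  \<comment> \<open>Up to time \<open>d'\<close> the solution for \<open>F \<circ> P\<close> stays
    in the ball, where \<open>P\<close> is the identity, so it solves the equation for
    \<open>F\<close> itself.\<close>
  define d' where "d' = min d e"
  have "(x has_vector_derivative F (x t)) (at t)" if t: "t \<in> {-d'<..<d'}" for t
  proof -
    have "x t \<in> cball x0 u"
      using e(2)[of t] t by (auto simp: d'_def x0 dist_commute abs_less_iff less_imp_le)
    thus ?thesis using deriv[of t] t
      by (auto simp: d'_def P_def closest_point_self)
  qed
  thus ?thesis
    using d e x0 by (intro that[of d' x]) (auto simp: d'_def is_solution_def is_interval_oo)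
qed

section \<open>Invariance of the sphere and tangency of the field\<close>

lemma inner_self_has_vector_derivative:
  assumes "(x has_vector_derivative v) (at t within A)"
  shows "((\<lambda>t. x t \<bullet> x t) has_real_derivative 2 * (x t \<bullet> v)) (at t within A)"
  using has_derivative_inner[OF assms[unfolded has_vector_derivative_def]
      assms[unfolded has_vector_derivative_def]]
  by (simp add: has_field_derivative_def inner_commute algebra_simps fun_eq_iff mult_commute_abs)

lemma flow_invariant_sphere_imp_tangent:
  fixes F :: "'a::euclidean_space \<Rightarrow> 'a"
  assumes inv: "flow_invariant F (sphere 0 1)" and y: "y \<in> sphere 0 1"
    and "u > 0" "L-lipschitz_on (cball y u) F"
  shows "y \<bullet> F y = 0"
proof -
  obtain d x where d: "d > 0" and x0: "x 0 = y" and sol: "is_solution F {-d<..<d} x"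
    using locally_lipschitz_ode_local_solution assms(3,4) by blast
  have norm: "x t \<bullet> x t = 1" if "t \<in> {-d<..<d}" for t
  proof -
    have "0 \<in> {-d<..<d}" using d by simp
    hence "x t \<in> sphere 0 1"
      using inv sol that x0 y unfolding flow_invariant_def by blast
    thus ?thesis by (simp add: dot_square_norm)
  qed
  have "(x has_vector_derivative F y) (at 0)"
    using sol d x0 by (auto simp: is_solution_def)
  from inner_self_has_vector_derivative[OF this]
  have "((\<lambda>t. x t \<bullet> x t) has_real_derivative 2 * (y \<bullet> F y)) (at 0)"
    by (simp add: x0)
  hence "((\<lambda>t. 1) has_real_derivative 2 * (y \<bullet> F y)) (at 0)"
    by (rule has_field_derivative_transform_within_open[OF _ open_greaterThanLessThan[of "-d" d]])
       (use d norm in auto)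
  thus ?thesis
    using DERIV_unique[OF _ DERIV_const[of "1::real"]] by fastforce
qed

text \<open>Integrating factor: \<open>V * exp (- K)\<close> is constant for an antiderivative
  \<open>K\<close> of \<open>k\<close>, and the exponential never vanishes. The zero
  \<open>s\<close> may lie anywhere in the interval, which covers forward and backward time
  alike.\<close>

lemma linear_ode_zero:
  fixes V k :: "real \<Rightarrow> real"
  assumes k: "continuous_on {a..b} k"
    and V: "\<And>t. t \<in> {a..b} \<Longrightarrow> (V has_real_derivative k t * V t) (at t within {a..b})"
    and s: "s \<in> {a..b}" "V s = 0" and t: "t \<in> {a..b}"
  shows "V t = 0"
proof -
  define K where "K t = integral {a..t} k" for t
  have K: "(K has_real_derivative k t) (at t within {a..b})" if "t \<in> {a..b}" for t
    unfolding K_def using integral_has_real_derivative[OF k that] .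
  have "((\<lambda>t. V t * exp (- K t)) has_real_derivative 0) (at t within {a..b})"
    if "t \<in> {a..b}" for t
    by (auto intro!: derivative_eq_intros V K that)
  then obtain C where "\<And>t. t \<in> {a..b} \<Longrightarrow> V t * exp (- K t) = C"
    using has_field_derivative_zero_constant[of "{a..b}" "\<lambda>t. V t * exp (- K t)"] by auto
  from this[of s] this[of t] s t show ?thesis by simp
qed

lemma flow_invariant_sphereI:
  fixes F :: "'a::euclidean_space \<Rightarrow> 'a"
  assumes g: "continuous_on UNIV g" and F: "\<And>y. y \<bullet> F y = g y * (y \<bullet> y - 1)"
  shows "flow_invariant F (sphere 0 1)"
  unfolding flow_invariant_def
proof (intro allI impI ballI)
  fix I x s t assume sol: "is_solution F I x" and s: "s \<in> I" "x s \<in> sphere 0 1" and t: "t \<in> I"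
  \<comment> \<open>A compact interval containing both times, whichever comes first; it lies in
    \<open>I\<close> because \<open>I\<close> is an interval.\<close>
  define A where "A = {min s t..max s t}"
  have "A \<subseteq> I"
  proof
    fix \<tau> assume "\<tau> \<in> A"
    moreover have "min s t \<in> I" "max s t \<in> I"
      using s t by (auto simp: min_def max_def)
    ultimately show "\<tau> \<in> I"
      using sol unfolding is_solution_def A_def is_interval_1 atLeastAtMost_iff by blast
  qed
  hence deriv: "(x has_vector_derivative F (x \<tau>)) (at \<tau> within A)" if "\<tau> \<in> A" for \<tau>
    using sol that by (auto simp: is_solution_def intro: has_vector_derivative_at_within)
  have contx: "continuous_on A x"
    using deriv has_vector_derivative_continuous continuous_on_eq_continuous_within by blast
  have "x t \<bullet> x t - 1 = 0"
  proof (rule linear_ode_zero[where s = s and V = "\<lambda>\<tau>. x \<tau> \<bullet> x \<tau> - 1" and k = "\<lambda>\<tau>. 2 * g (x \<tau>)"])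
    show "continuous_on {min s t..max s t} (\<lambda>\<tau>. 2 * g (x \<tau>))"
      using contx unfolding A_def
      by (intro continuous_intros continuous_on_compose2[OF g]) auto
    show "((\<lambda>\<tau>. x \<tau> \<bullet> x \<tau> - 1) has_real_derivative 2 * g (x \<tau>) * (x \<tau> \<bullet> x \<tau> - 1))
        (at \<tau> within {min s t..max s t})" if "\<tau> \<in> {min s t..max s t}" for \<tau>
      using inner_self_has_vector_derivative[OF deriv] that unfolding A_def F
      by (auto intro!: derivative_eq_intros)
    show "x s \<bullet> x s - 1 = 0" using s by (simp add: dot_square_norm)
  qed auto
  thus "x t \<in> sphere 0 1" by (simp add: dot_square_norm norm_eq_1)
qed

section \<open>Lipschitz continuity of the field on bounded sets\<close>

text \<open>This and the following closure rules hide the constant behind an existential, so that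
  they can be chained along the structure of a polynomial without computing constants.\<close>

lemma ex_lipschitz_on_const: "\<exists>L. L-lipschitz_on U (\<lambda>x. c)"
  using lipschitz_on_constant by (rule exI)

lemma ex_lipschitz_on_add:
  fixes f g :: "'a::metric_space \<Rightarrow> 'b::real_normed_vector"
  assumes "\<exists>L. L-lipschitz_on U f" "\<exists>L. L-lipschitz_on U g"
  shows "\<exists>L. L-lipschitz_on U (\<lambda>x. f x + g x)"
  using assms lipschitz_on_add by blast

lemma ex_lipschitz_on_sum:
  fixes f :: "'i \<Rightarrow> 'a::metric_space \<Rightarrow> 'b::real_normed_vector"
  assumes "\<And>i. i \<in> I \<Longrightarrow> \<exists>L. L-lipschitz_on U (f i)"
  shows "\<exists>L. L-lipschitz_on U (\<lambda>x. \<Sum>i\<in>I. f i x)"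
  using assms
  by (induction I rule: infinite_finite_induct)
     (simp_all add: ex_lipschitz_on_const ex_lipschitz_on_add)

lemma lipschitz_on_imp_bounded_image:
  assumes "L-lipschitz_on U f" "bounded U"
  shows "bounded (f ` U)"
proof (cases "U = {}")
  case False
  then obtain y where y: "y \<in> U" by blast
  obtain e where e: "\<And>x. x \<in> U \<Longrightarrow> dist y x \<le> e"
    using assms(2) bounded_any_center[of U y] by blast
  have "dist (f y) (f x) \<le> L * e" if "x \<in> U" for x
    using lipschitz_onD[OF assms(1) y that] e[OF that] lipschitz_on_nonneg[OF assms(1)]
    by (meson mult_left_mono order_trans)
  thus ?thesis unfolding bounded_def by blast
qed simp

text \<open>A difference of products splits as in the product rule, and both factors are bounded
  because \<open>U\<close> is. The scalar form serves products of polynomials as well as polynomial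
  multiples of basis vectors.\<close>

lemma ex_lipschitz_on_scaleR:
  fixes f :: "'a::metric_space \<Rightarrow> real" and g :: "'a \<Rightarrow> 'b::real_normed_vector"
  assumes U: "bounded U" and "\<exists>L. L-lipschitz_on U f" "\<exists>L. L-lipschitz_on U g"
  shows "\<exists>L. L-lipschitz_on U (\<lambda>x. f x *\<^sub>R g x)"
proof -
  obtain L M where L: "L-lipschitz_on U f" and M: "M-lipschitz_on U g"
    using assms by blast
  obtain B where B: "B > 0" "\<And>x. x \<in> U \<Longrightarrow> norm (f x) \<le> B"
    using lipschitz_on_imp_bounded_image[OF L U] unfolding bounded_pos by blast
  obtain C where C: "C > 0" "\<And>x. x \<in> U \<Longrightarrow> norm (g x) \<le> C"
    using lipschitz_on_imp_bounded_image[OF M U] unfolding bounded_pos by blast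
  have "(B * M + L * C)-lipschitz_on U (\<lambda>x. f x *\<^sub>R g x)"
  proof (rule lipschitz_onI)
    fix x y assume xy: "x \<in> U" "y \<in> U"
    have "dist (f x *\<^sub>R g x) (f y *\<^sub>R g y) = norm (f x *\<^sub>R (g x - g y) + (f x - f y) *\<^sub>R g y)"
      by (simp add: dist_norm algebra_simps)
    also have "\<dots> \<le> norm (f x) * norm (g x - g y) + norm (f x - f y) * norm (g y)"
      by (metis norm_scaleR norm_triangle_ineq real_norm_def)
    also have "\<dots> \<le> B * (M * dist x y) + (L * dist x y) * C"
      using xy B C lipschitz_onD[OF L xy] lipschitz_onD[OF M xy] lipschitz_on_nonneg[OF L]
      by (intro add_mono mult_mono) (auto simp: dist_norm)
    finally show "dist (f x *\<^sub>R g x) (f y *\<^sub>R g y) \<le> (B * M + L * C) * dist x y"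
      by (simp add: algebra_simps)
  qed (use B C lipschitz_on_nonneg[OF L] lipschitz_on_nonneg[OF M] in auto)
  thus ?thesis ..
qed

lemmas ex_lipschitz_on_mult =
  ex_lipschitz_on_scaleR[where 'b = real, unfolded real_scaleR_def]

lemma ex_lipschitz_on_component: "\<exists>L. L-lipschitz_on U (\<lambda>x :: real ^ 'n. x $ i)"
  by (metis bounded_linear.lipschitz_boundE bounded_linear_vec_nth)

lemma kolmogorov_field_lipschitz:
  assumes "bounded U"
  shows "\<exists>L. L-lipschitz_on U (kolmogorov_field r a b c a2 b2 c2)"
proof -
  have q: "\<exists>L. L-lipschitz_on U (\<lambda>x. x $ i * quadratic_factor \<rho> l q x)" for i \<rho> l q
    unfolding quadratic_factor_def
    by (intro ex_lipschitz_on_mult ex_lipschitz_on_add ex_lipschitz_on_sum ex_lipschitz_on_component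
        assms ex_lipschitz_on_const)
  have *: "kolmogorov_field r a b c a2 b2 c2 =
      (\<lambda>x. (x $ 1 * quadratic_factor (r 1) a a2 x) *\<^sub>R axis 1 1 +
           (x $ 2 * quadratic_factor (r 2) b b2 x) *\<^sub>R axis 2 1 +
           (x $ 3 * quadratic_factor (r 3) c c2 x) *\<^sub>R axis 3 1)"
    by (auto simp: kolmogorov_field_def fun_eq_iff vec_eq_iff forall_3 axis_def)
  show ?thesis
    unfolding *
    by (intro ex_lipschitz_on_scaleR ex_lipschitz_on_add q assms ex_lipschitz_on_const)
qed

section \<open>Coefficients of a quartic vanishing on a circle or on the sphere\<close>

lemma quartic_zero_on_circle:
  fixes \<rho> \<sigma> :: real
  assumes h: "\<And>u v. u\<^sup>2 + v\<^sup>2 = 1 \<Longrightarrow>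
      u\<^sup>2 * (\<rho> + p1 * u + p2 * v + p11 * u\<^sup>2 + p12 * u * v + p22 * v\<^sup>2) +
      v\<^sup>2 * (\<sigma> + q1 * u + q2 * v + q11 * u\<^sup>2 + q12 * u * v + q22 * v\<^sup>2) = 0"
  shows "p1 = 0" "p2 = 0" "q1 = 0" "q2 = 0" "p12 = 0" "q12 = 0"
    "p11 = - \<rho>" "q22 = - \<sigma>" "p22 = - (\<rho> + \<sigma> + q11)"
proof -
  show axes: "p1 = 0" "q2 = 0" "p11 = - \<rho>" "q22 = - \<sigma>"
    using h[of 1 0] h[of "-1" 0] h[of 0 1] h[of 0 "-1"] by simp_all
  have h': "p2 * u + q1 * v + p12 * u\<^sup>2 + q12 * v\<^sup>2 + (\<rho> + p22 + \<sigma> + q11) * (u * v) = 0"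
    if uv: "u\<^sup>2 + v\<^sup>2 = 1" "u \<noteq> 0" "v \<noteq> 0" for u v
  proof -
    \<comment> \<open>Writing the factor 1 of \<open>\<rho>\<close> and \<open>\<sigma>\<close> as
      \<open>u\<^sup>2 + v\<^sup>2\<close> cancels the pure fourth powers, and what remains is
      divisible by \<open>u * v\<close>.\<close>
    have "u\<^sup>2 * (\<rho> * (u\<^sup>2 + v\<^sup>2) + p2 * v - \<rho> * u\<^sup>2 + p12 * u * v + p22 * v\<^sup>2) +
      v\<^sup>2 * (\<sigma> * (u\<^sup>2 + v\<^sup>2) + q1 * u + q11 * u\<^sup>2 + q12 * u * v - \<sigma> * v\<^sup>2) = 0"
      using h[OF uv(1)] unfolding uv(1) axes by simp
    hence "(u * v) * (p2 * u + q1 * v + p12 * u\<^sup>2 + q12 * v\<^sup>2 + (\<rho> + p22 + \<sigma> + q11) * (u * v)) = 0"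
      by (simp add: power2_eq_square algebra_simps)
    with uv(2,3) show ?thesis by simp
  qed
  \<comment> \<open>The circle is symmetric under both sign changes, and the three groups of terms
    behave differently under them, so each vanishes separately.\<close>
  have signs: "p2 * u + q1 * v = 0" "p12 * u\<^sup>2 + q12 * v\<^sup>2 = 0" "(\<rho> + p22 + \<sigma> + q11) * (u * v) = 0"
    if "u\<^sup>2 + v\<^sup>2 = 1" "u \<noteq> 0" "v \<noteq> 0" for u v
  proof -
    let ?T = "(\<rho> + p22 + \<sigma> + q11) * (u * v)"
    have "p2 * u + q1 * v + p12 * u\<^sup>2 + q12 * v\<^sup>2 + ?T = 0"
      using h'[of u v] that by simp
    moreover have "- (p2 * u) + q1 * v + p12 * u\<^sup>2 + q12 * v\<^sup>2 - ?T = 0"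
      using h'[of "-u" v] that by simp
    moreover have "p2 * u - q1 * v + p12 * u\<^sup>2 + q12 * v\<^sup>2 - ?T = 0"
      using h'[of u "-v"] that by simp
    moreover have "- (p2 * u) - q1 * v + p12 * u\<^sup>2 + q12 * v\<^sup>2 + ?T = 0"
      using h'[of "-u" "-v"] that by simp
    ultimately show "p2 * u + q1 * v = 0" "p12 * u\<^sup>2 + q12 * v\<^sup>2 = 0" "?T = 0"
      by linarith+
  qed
  \<comment> \<open>A rational point with distinct nonzero coordinates and its mirror image give
    nonsingular 2 by 2 systems for \<open>p2\<close>, \<open>q1\<close> and for \<open>p12\<close>,
    \<open>q12\<close>.\<close>
  note signs' = signs[of "3/5" "4/5"] signs[of "4/5" "3/5"]
  show "p2 = 0" "q1 = 0" "p12 = 0" "q12 = 0" "p22 = - (\<rho> + \<sigma> + q11)"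
    using signs' by (simp_all add: power2_eq_square)
qed

text \<open>Half the derivative of the squared norm along the field, written in scalar variables so
  that setting one of them to 0 simplifies to the quartic on a coordinate circle.\<close>

definition radial_component ::
  "(nat \<Rightarrow> real) \<Rightarrow> (nat \<Rightarrow> real) \<Rightarrow> (nat \<Rightarrow> real) \<Rightarrow> (nat \<Rightarrow> real) \<Rightarrow>
   (nat \<Rightarrow> nat \<Rightarrow> real) \<Rightarrow> (nat \<Rightarrow> nat \<Rightarrow> real) \<Rightarrow> (nat \<Rightarrow> nat \<Rightarrow> real) \<Rightarrow>
   real \<Rightarrow> real \<Rightarrow> real \<Rightarrow> real" where
  "radial_component r a b c a2 b2 c2 u v w =
       u\<^sup>2 * (r 1 + a 1 * u + a 2 * v + a 3 * w + a2 1 1 * u\<^sup>2 + a2 1 2 * u * v + a2 1 3 * u * w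
             + a2 2 2 * v\<^sup>2 + a2 2 3 * v * w + a2 3 3 * w\<^sup>2) +
       v\<^sup>2 * (r 2 + b 1 * u + b 2 * v + b 3 * w + b2 1 1 * u\<^sup>2 + b2 1 2 * u * v + b2 1 3 * u * w
             + b2 2 2 * v\<^sup>2 + b2 2 3 * v * w + b2 3 3 * w\<^sup>2) +
       w\<^sup>2 * (r 3 + c 1 * u + c 2 * v + c 3 * w + c2 1 1 * u\<^sup>2 + c2 1 2 * u * v + c2 1 3 * u * w
             + c2 2 2 * v\<^sup>2 + c2 2 3 * v * w + c2 3 3 * w\<^sup>2)"

lemma kolmogorov_field_inner_self:
  "x \<bullet> kolmogorov_field r a b c a2 b2 c2 x =
     radial_component r a b c a2 b2 c2 (x $ 1) (x $ 2) (x $ 3)"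
proof -
  have I: "{1..3} = {1, 2, 3::nat}" "{2..3} = {2, 3::nat}" "{3..3} = {3::nat}" "{Suc 0..3} = {1, 2, 3::nat}"
    by auto
  show ?thesis
    unfolding kolmogorov_field_def quadratic_factor_def inner_vec_def sum_3 radial_component_def
    by (simp add: I algebra_simps power2_eq_square)
qed

lemma radial_component_zero_on_sphere:
  fixes r a b c :: "nat \<Rightarrow> real"
    and a2 b2 c2 :: "nat \<Rightarrow> nat \<Rightarrow> real"
  assumes "\<And>u v w. u\<^sup>2 + v\<^sup>2 + w\<^sup>2 = 1 \<Longrightarrow>
    radial_component r a b c a2 b2 c2 u v w = 0"
  shows "a 1 = 0 \<and> a 2 = 0 \<and> a 3 = 0 \<and> b 1 = 0 \<and> b 2 = 0 \<and> b 3 = 0 \<and> c 1 = 0 \<and> c 2 = 0 \<and> c 3 = 0 \<and>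
    a2 1 2 = 0 \<and> a2 1 3 = 0 \<and> a2 2 3 = 0 \<and> b2 1 2 = 0 \<and> b2 1 3 = 0 \<and> b2 2 3 = 0 \<and>
    c2 1 2 = 0 \<and> c2 1 3 = 0 \<and> c2 2 3 = 0 \<and>
    a2 1 1 = - r 1 \<and> a2 2 2 = - (r 1 + r 2 + b2 1 1) \<and>
    b2 2 2 = - r 2 \<and> b2 3 3 = - (r 2 + r 3 + c2 2 2) \<and>
    c2 1 1 = - (r 1 + r 3 + a2 3 3) \<and> c2 3 3 = - r 3"
proof -
  note p = assms[unfolded radial_component_def]
  \<comment> \<open>The coefficients \<open>a2 2 3\<close>, \<open>b2 1 3\<close>,
    \<open>c2 1 2\<close> belong to monomials containing all three variables, so no coordinate
    circle detects them.\<close>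
  note uv = quartic_zero_on_circle[OF p[of _ _ 0, simplified]]
  note uw = quartic_zero_on_circle[OF p[of _ 0, simplified]]
  note vw = quartic_zero_on_circle[OF p[of 0, simplified]]
  have xyz: "u * v * w * (a2 2 3 * u + b2 1 3 * v + c2 1 2 * w) = 0"
    if uvw: "u\<^sup>2 + v\<^sup>2 + w\<^sup>2 = 1" for u v w
  proof -
    \<comment> \<open>As on the circle, writing 1 as the sum of squares makes the expression
      homogeneous; the relations from the circles then cancel every term not divisible by
      \<open>u * v * w\<close>.\<close>
    have "u\<^sup>2 * (r 1 * (u\<^sup>2 + v\<^sup>2 + w\<^sup>2) - r 1 * u\<^sup>2
             + (- r 1 - r 2 - b2 1 1) * v\<^sup>2 + a2 2 3 * v * w + (- r 1 - r 3 - c2 1 1) * w\<^sup>2) +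
       v\<^sup>2 * (r 2 * (u\<^sup>2 + v\<^sup>2 + w\<^sup>2) + b2 1 1 * u\<^sup>2 + b2 1 3 * u * w
             - r 2 * v\<^sup>2 + (- r 2 - r 3 - c2 2 2) * w\<^sup>2) +
       w\<^sup>2 * (r 3 * (u\<^sup>2 + v\<^sup>2 + w\<^sup>2) + c2 1 1 * u\<^sup>2 + c2 1 2 * u * v
             + c2 2 2 * v\<^sup>2 - r 3 * w\<^sup>2) = 0"
      using p[OF uvw] unfolding uvw by (simp add: uv uw vw)
    thus ?thesis by (simp add: power2_eq_square algebra_simps)
  qed
  \<comment> \<open>The permutations of (1/3, 2/3, 2/3) are rational points of the sphere off the
    coordinate planes; their linear system has determinant 5 after scaling by 3.\<close>
  have "a2 2 3 + 2 * b2 1 3 + 2 * c2 1 2 = 0" "2 * a2 2 3 + b2 1 3 + 2 * c2 1 2 = 0"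
    "2 * a2 2 3 + 2 * b2 1 3 + c2 1 2 = 0"
    using xyz[of "1/3" "2/3" "2/3"] xyz[of "2/3" "1/3" "2/3"] xyz[of "2/3" "2/3" "1/3"]
    by (simp_all add: power2_eq_square)
  hence "a2 2 3 = 0" "b2 1 3 = 0" "c2 1 2 = 0" by linarith+
  with uv uw vw show ?thesis by simp
qed

section \<open>The equivalence in terms of the coefficients\<close>

lemma ball_1_3: "(\<forall>i\<in>{1..3::nat}. P i) \<longleftrightarrow> P 1 \<and> P 2 \<and> P 3"
proof -
  have "{1..3::nat} = {1, 2, 3}" by auto
  thus ?thesis by simp
qed

lemma ball_less_1_3:
  "(\<forall>j\<in>{1<..3::nat}. P j) \<longleftrightarrow> P 2 \<and> P 3"
  "(\<forall>j\<in>{2<..3::nat}. P j) \<longleftrightarrow> P 3"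
  "(\<forall>j\<in>{3<..3::nat}. P j) \<longleftrightarrow> True"
proof -
  have "{1<..3::nat} = {2, 3}" "{2<..3::nat} = {3}" by auto
  thus "(\<forall>j\<in>{1<..3::nat}. P j) \<longleftrightarrow> P 2 \<and> P 3" "(\<forall>j\<in>{2<..3::nat}. P j) \<longleftrightarrow> P 3"
    "(\<forall>j\<in>{3<..3::nat}. P j) \<longleftrightarrow> True" by simp_all
qed

theorem proposition2p2:
  fixes r a b c :: "nat \<Rightarrow> real"
    and a2 b2 c2 :: "nat \<Rightarrow> nat \<Rightarrow> real"
  shows "flow_invariant (kolmogorov_field r a b c a2 b2 c2) (sphere 0 1) \<longleftrightarrow>
    (\<forall>i\<in>{1..3}. a i = 0 \<and> b i = 0 \<and> c i = 0) \<and>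
    (\<forall>i\<in>{1..3}. \<forall>j\<in>{i<..3}. a2 i j = 0 \<and> b2 i j = 0 \<and> c2 i j = 0) \<and>
    a2 1 1 = - r 1 \<and> a2 2 2 = - (r 1 + r 2 + b2 1 1) \<and>
    b2 2 2 = - r 2 \<and> b2 3 3 = - (r 2 + r 3 + c2 2 2) \<and>
    c2 1 1 = - (r 1 + r 3 + a2 3 3) \<and> c2 3 3 = - r 3"
proof (rule iffI, goal_cases)
  case 1
  have "radial_component r a b c a2 b2 c2 u v w = 0" if "u\<^sup>2 + v\<^sup>2 + w\<^sup>2 = 1" for u v w
  proof -
    define y :: "real ^ 3" where "y = vector [u, v, w]"
    have "y \<bullet> y = 1"
      using that by (simp add: y_def inner_vec_def sum_3 power2_eq_square)
    hence "y \<in> sphere 0 1" by (simp add: norm_eq_1)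
    moreover obtain L where "L-lipschitz_on (cball y 1) (kolmogorov_field r a b c a2 b2 c2)"
      using kolmogorov_field_lipschitz bounded_cball by blast
    ultimately have "y \<bullet> kolmogorov_field r a b c a2 b2 c2 y = 0"
      using flow_invariant_sphere_imp_tangent[OF 1, of y 1] by simp
    thus ?thesis
      by (simp add: kolmogorov_field_inner_self y_def)
  qed
  from radial_component_zero_on_sphere[OF this] show ?case
    by (simp only: ball_1_3 ball_less_1_3 simp_thms)
next
  case 2
  hence eqs: "a 1 = 0" "a 2 = 0" "a 3 = 0" "b 1 = 0" "b 2 = 0" "b 3 = 0" "c 1 = 0" "c 2 = 0" "c 3 = 0"
    "a2 1 2 = 0" "a2 1 3 = 0" "a2 2 3 = 0" "b2 1 2 = 0" "b2 1 3 = 0" "b2 2 3 = 0"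
    "c2 1 2 = 0" "c2 1 3 = 0" "c2 2 3 = 0" "a2 1 1 = - r 1" "a2 2 2 = - (r 1 + r 2 + b2 1 1)"
    "b2 2 2 = - r 2" "b2 3 3 = - (r 2 + r 3 + c2 2 2)"
    "c2 1 1 = - (r 1 + r 3 + a2 3 3)" "c2 3 3 = - r 3"
    by (simp_all only: ball_1_3 ball_less_1_3 simp_thms)
  show ?case
  proof (rule flow_invariant_sphereI)
    \<comment> \<open>The cofactor is minus the quadratic part of \<open>y \<bullet> F y\<close>,
      for \<open>F\<close> the Kolmogorov field: under the relations the quartic part is this
      cofactor times \<open>y \<bullet> y\<close>.\<close>
    show "continuous_on UNIV (\<lambda>y::real^3. - (r 1 * (y $ 1)\<^sup>2 + r 2 * (y $ 2)\<^sup>2 + r 3 * (y $ 3)\<^sup>2))"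
      by (intro continuous_intros)
    show "y \<bullet> kolmogorov_field r a b c a2 b2 c2 y =
        - (r 1 * (y $ 1)\<^sup>2 + r 2 * (y $ 2)\<^sup>2 + r 3 * (y $ 3)\<^sup>2) * (y \<bullet> y - 1)" for y
      unfolding kolmogorov_field_inner_self radial_component_def eqs
      unfolding inner_vec_def sum_3
      by (simp add: power2_eq_square algebra_simps)
  qed
qed

end
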